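(* As formal power series in $q$, \[ (-q;q)_\infty = \sum_{n\geq k\geq 0} q^{n(2n-1) + 3k}\, Y_{q^2}(2n-k,k)\,(q^2;q^2)_{2n}^{-1}\,[2(n-k)+1]_q . \]
   Context: $(a;q)_k=\prod_{j=0}^{k-1}(1-aq^j)$, $(a;q)_0=1$, $(a;q)_\infty=\prod_{j\ge0}(1-aq^j)$ (and likewise with base $q^2$). For $m\ge 0$: $[m]_q=1+q+\cdots+q^{m-1}$, $[m]_q!=[m]_q[m-1]_q\cdots[1]_q$, and for $m\ge j\ge 0$, $\begin{bmatrix} m\\ j\end{bmatrix}_q=\frac{[m]_q!}{[j]_q![m-j]_q!}$. For $m\ge j\ge 0$ the $q$-Yamanouchi number is $Y_q(m,j)=\frac{[m-j+1]_q}{[m+1]_q}\begin{bmatrix} m+j\\ m\end{bmatrix}_q$; $Y_{q^2}$ denotes this with $q$ replaced by $q^2$. *)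

theory Defs
  imports
    "HOL-Computational_Algebra.Formal_Power_Series"
    "HOL-Analysis.Infinite_Products"
    "HOL-Analysis.Infinite_Sum"
begin

text \<open>
  The base \<open>q\<close> is itself a formal power series, so that it can be instantiated both with the
  indeterminate \<open>X\<close> and with \<open>X\<^sup>2\<close>.  Limits, infinite products and infinite sums of formal
  power series are taken with respect to the library's \<open>X\<close>-adic metric.  For \<open>q\<close> with
  vanishing constant term, every denominator below has constant term \<open>1\<close> and is therefore a
  unit, so the divisions are exact.
\<close>

definition qpoch :: "'a::field fps \<Rightarrow> 'a fps \<Rightarrow> nat \<Rightarrow> 'a fps" where
  "qpoch a q k = (\<Prod>j<k. 1 - a * q ^ j)"

definition qpoch_inf :: "'a::field fps \<Rightarrow> 'a fps \<Rightarrow> 'a fps" where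
  "qpoch_inf a q = (\<Prod>j. 1 - a * q ^ j)"

definition qint :: "'a::field fps \<Rightarrow> nat \<Rightarrow> 'a fps" where
  "qint q m = (\<Sum>i<m. q ^ i)"

definition qfact :: "'a::field fps \<Rightarrow> nat \<Rightarrow> 'a fps" where
  "qfact q m = (\<Prod>i=1..m. qint q i)"

text \<open>Only meaningful for \<open>j \<le> m\<close>, because of the truncated subtraction; likewise for
  \<open>qYamanouchi\<close>.\<close>

definition qbinom :: "'a::field fps \<Rightarrow> nat \<Rightarrow> nat \<Rightarrow> 'a fps" where
  "qbinom q m j = qfact q m / (qfact q j * qfact q (m - j))"

definition qYamanouchi :: "'a::field fps \<Rightarrow> nat \<Rightarrow> nat \<Rightarrow> 'a fps" where
  "qYamanouchi q m j = qint q (m - j + 1) / qint q (m + 1) * qbinom q (m + j) m"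

text \<open>The infinite product in \<open>qpoch_inf\<close> converges whenever \<open>a\<close> and \<open>q\<close> have vanishing
  constant term, in particular for \<open>(-q; q)\<^sub>\<infinity>\<close>.\<close>

lemma convergent_prod_qpoch_inf:
  fixes a q :: "'a::field fps"
  assumes a: "fps_nth a 0 = 0" and q: "fps_nth q 0 = 0"
  shows "convergent_prod (\<lambda>j. 1 - a * q ^ j)"
proof -
  define P where "P n = (\<Prod>j\<le>n. 1 - a * q ^ j)" for n
  have step: "fps_nth (P (Suc n)) i = fps_nth (P n) i" if "i \<le> n" for n i
  proof -
    have z: "fps_nth (q ^ Suc n) l = 0" if "l \<le> n" for l
      using startsby_zero_power_prefix[OF q, of "Suc n"] that by (simp del: power_Suc)
    have "fps_nth (P n * a * q ^ Suc n) i = 0"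
      unfolding fps_mult_nth[of "P n * a"] using that by (intro sum.neutral) (auto simp: z simp del: power_Suc)
    moreover have "P (Suc n) = P n - P n * a * q ^ Suc n"
      by (simp add: P_def algebra_simps)
    ultimately show ?thesis by simp
  qed
  have const: "fps_nth (P n) i = fps_nth (P i) i" if "i \<le> n" for n i
    using that by (induction n rule: dec_induct) (auto simp: step)
  define L where "L = Abs_fps (\<lambda>i. fps_nth (P i) i)"
  have "P \<longlonglongrightarrow> L"
    unfolding tendsto_fps_iff L_def
    by (auto intro!: eventually_mono[OF eventually_ge_at_top] const)
  moreover have "L \<noteq> 0"
  proof -
    have "fps_nth L 0 = 1" using a by (simp add: L_def P_def)
    then show ?thesis by auto
  qed
  ultimately have "raw_has_prod (\<lambda>j. 1 - a * q ^ j) 0 L"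
    by (simp add: raw_has_prod_def P_def[abs_def])
  then show ?thesis by (auto simp: convergent_prod_def)
qed

end

theory Submission
  imports Defs
begin

text \<open>
  Since \<open>q\<^bsup>2k\<^esup> Y(2n - k, k) = [2n, k] - [2n, k - 1]\<close> for the Gaussian binomials in base
  \<open>q\<^sup>2\<close>, summation by parts turns the inner sum over \<open>k\<close> into
  \<open>\<Sum>k\<le>2n. q\<^sup>k [2n, k] = (-q; q)\<^bsub>2n\<^esub>\<close>, so the right-hand side is
  \<open>\<Sum>n. q\<^bsup>n(2n-1)\<^esup> / (q; q)\<^bsub>2n\<^esub>\<close>. This is the even part of Euler's series
  \<open>\<Sum>m. z\<^sup>m q\<^bsup>m(m-1)/2\<^esup> / (q; q)\<^sub>m = (-z; q)\<^sub>\<infinity>\<close> at \<open>z = 1\<close>, and the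
  series vanishes at \<open>z = -1\<close>.
\<close>

section \<open>Recurrences for finite q-Pochhammer products\<close>

lemma qpoch_0 [simp]: "qpoch a q 0 = 1"
  by (simp add: qpoch_def)

lemma qpoch_Suc: "qpoch a q (Suc k) = qpoch a q k * (1 - a * q ^ k)"
  by (simp add: qpoch_def)

lemma qpoch_Suc_shift: "qpoch a q (Suc k) = (1 - a) * qpoch (a * q) q k"
  unfolding qpoch_def prod.lessThan_Suc_shift by (simp add: mult.assoc)

lemma qpoch_nth_0:
  assumes "fps_nth q 0 = 0"
  shows "fps_nth (qpoch q q k) 0 = 1"
  using assms by (induction k) (simp_all add: qpoch_Suc)

lemma inverse_qpoch_Suc:
  fixes q :: "'a::field fps"
  assumes "fps_nth q 0 = 0"
  shows "(1 - q ^ Suc k) * inverse (qpoch q q (Suc k)) = inverse (qpoch q q k)"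
proof -
  have "inverse (1 - q ^ Suc k) * (1 - q ^ Suc k) = 1"
    using assms by (intro inverse_mult_eq_1) simp
  then show ?thesis
    by (simp add: qpoch_Suc fps_inverse_mult mult.left_commute mult.commute)
qed

section \<open>Dilation equations for q-exponential series\<close>

text \<open>Euler's series for \<open>1 / (x; q)_\<infinity>\<close> in the outer indeterminate
  \<open>x\<close>.\<close>

definition qexp :: "'a::field fps \<Rightarrow> 'a fps fps" where
  "qexp q = Abs_fps (\<lambda>k. inverse (qpoch q q k))"

text \<open>Euler's series for \<open>(-z x; q)\<^sub>\<infinity>\<close> in the outer indeterminate \<open>x\<close>.\<close>

definition qExp :: "'a::field fps \<Rightarrow> 'a fps \<Rightarrow> 'a fps fps" where
  "qExp q z = Abs_fps (\<lambda>m. q ^ (m choose 2) * inverse (qpoch q q m) * z ^ m)"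

definition dilate :: "'a::comm_ring_1 \<Rightarrow> 'a fps \<Rightarrow> 'a fps" where
  "dilate c F = F oo (fps_const c * fps_X)"

lemma dilate_nth [simp]: "fps_nth (dilate c F) n = c ^ n * fps_nth F n"
  by (simp add: dilate_def fps_compose_linear)

lemma dilate_mult: "dilate (c :: 'a::idom) (F * G) = dilate c F * dilate c G"
  by (simp add: dilate_def fps_compose_mult_distrib)

lemma dilate_dilate: "dilate c (dilate d F) = dilate (c * d) F"
  by (rule fps_ext) (simp add: power_mult_distrib mult.assoc)

text \<open>Series form of \<open>(x; q)_\<infinity> = (1 - x) (q x; q)_\<infinity>\<close>.\<close>

lemma dilate_qexp:
  fixes q :: "'a::field fps"
  assumes "fps_nth q 0 = 0"
  shows "dilate q (qexp q) = (1 - fps_X) * qexp q"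
proof (rule fps_ext)
  fix n
  show "fps_nth (dilate q (qexp q)) n = fps_nth ((1 - fps_X) * qexp q) n"
    using inverse_qpoch_Suc[OF assms, symmetric]
    by (cases n) (simp_all add: qexp_def algebra_simps)
qed

text \<open>Comparing coefficients of \<open>x^(n+1)\<close> gives a recurrence whose factor
  \<open>1 - q^(n+1)\<close> is nonzero, so the constant term determines the solution.\<close>

lemma dilate_eq_imp_qexp:
  fixes q :: "'a::field fps"
  assumes q: "fps_nth q 0 = 0" and F0: "fps_nth F 0 = 1"
    and F: "dilate q F = (1 - fps_X) * F"
  shows "F = qexp q"
proof (rule fps_ext)
  fix n
  show "fps_nth F n = fps_nth (qexp q) n"
  proof (induction n)
    case 0
    then show ?case by (simp add: F0 qexp_def)
  next
    case (Suc n)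
    have "(1 - q ^ Suc n) * fps_nth F (Suc n) = fps_nth F n"
      using arg_cong[OF F, of "\<lambda>F. fps_nth F (Suc n)"] by (simp add: algebra_simps)
    also have "\<dots> = (1 - q ^ Suc n) * fps_nth (qexp q) (Suc n)"
      using inverse_qpoch_Suc[OF q] by (simp add: Suc qexp_def)
    finally have "(1 - q ^ Suc n) * fps_nth F (Suc n)
      = (1 - q ^ Suc n) * fps_nth (qexp q) (Suc n)" .
    moreover have "fps_nth (1 - q ^ Suc n) 0 \<noteq> 0"
      using q by simp
    then have "1 - q ^ Suc n \<noteq> 0"
      by (metis fps_zero_nth)
    ultimately show ?case
      by (metis mult_left_cancel)
  qed
qed

text \<open>Reflects the splitting of \<open>(x; q)_\<infinity>\<close> into factors of even and odd
  index. Two dilations by \<open>q\<close> make one by \<open>q^2\<close>, so a single one swaps the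
  two series up to \<open>1 - x\<close>, and uniqueness applies.\<close>

lemma qexp_square:
  fixes q :: "'a::field fps"
  assumes q: "fps_nth q 0 = 0"
  shows "dilate q (qexp (q ^ 2)) * qexp (q ^ 2) = qexp q"
proof (rule dilate_eq_imp_qexp[OF q])
  have "dilate q (dilate q (qexp (q ^ 2))) = (1 - fps_X) * qexp (q ^ 2)"
    using dilate_qexp[of "q ^ 2"] q by (simp add: dilate_dilate power2_eq_square)
  then show "dilate q (dilate q (qexp (q ^ 2)) * qexp (q ^ 2))
    = (1 - fps_X) * (dilate q (qexp (q ^ 2)) * qexp (q ^ 2))"
    by (simp add: dilate_mult mult.assoc mult.left_commute mult.commute)
qed (simp add: qexp_def)

text \<open>A rescaled evaluation of the Rogers--Szego polynomials in base \<open>q\<^sup>2\<close> at \<open>q\<close>.\<close>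

lemma sum_inverse_qpoch_square:
  fixes q :: "'a::field fps"
  assumes "fps_nth q 0 = 0"
  shows "(\<Sum>k\<le>N. q ^ k * (inverse (qpoch (q ^ 2) (q ^ 2) k) * inverse (qpoch (q ^ 2) (q ^ 2) (N - k))))
    = inverse (qpoch q q N)"
  using arg_cong[OF qexp_square[OF assms], of "\<lambda>F. fps_nth F N"]
  by (simp add: fps_mult_nth qexp_def atLeast0AtMost mult.assoc)

text \<open>Series form of
  \<open>(-z x; q)_\<infinity> = (1 + z x) (-z q x; q)_\<infinity>\<close>.\<close>

lemma qExp_dilate:
  fixes q z :: "'a::field fps"
  assumes q: "fps_nth q 0 = 0"
  shows "qExp q z = (1 + fps_const z * fps_X) * dilate q (qExp q z)"
proof (rule fps_ext)
  fix n
  show "fps_nth (qExp q z) n = fps_nth ((1 + fps_const z * fps_X) * dilate q (qExp q z)) n"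
  proof (cases n)
    case 0
    then show ?thesis by (simp add: qExp_def binomial_eq_0)
  next
    case (Suc m)
    have c: "Suc m choose 2 = m + (m choose 2)"
      by (simp add: numeral_2_eq_2)
    define u where "u = inverse (qpoch q q (Suc m))"
    have "inverse (qpoch q q m) = (1 - q ^ Suc m) * u"
      using inverse_qpoch_Suc[OF q] by (simp add: u_def)
    then show ?thesis
      using Suc by (simp add: qExp_def c power_add distrib_right mult.assoc flip: u_def)
        (simp add: algebra_simps)
  qed
qed

text \<open>A rescaled finite \<open>q\<close>-binomial theorem.\<close>

lemma qexp_qExp_nth:
  fixes q z :: "'a::field fps"
  assumes q: "fps_nth q 0 = 0"
  shows "fps_nth (qexp q * qExp q z) N = qpoch (- z) q N * inverse (qpoch q q N)"
proof (induction N)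
  case 0
  then show ?case by (simp add: qexp_def qExp_def binomial_eq_0)
next
  case (Suc N)
  define G where "G = qexp q * qExp q z"
  \<comment> \<open>The dilation equations of both factors combine into one for \<open>G\<close>,
    that is, a first-order recurrence for its coefficients.\<close>
  have "(1 + fps_const z * fps_X) * dilate q G
    = dilate q (qexp q) * ((1 + fps_const z * fps_X) * dilate q (qExp q z))"
    by (simp only: G_def dilate_mult mult_ac)
  also have "\<dots> = (1 - fps_X) * G"
    using dilate_qexp[OF q] qExp_dilate[OF q, of z] by (simp add: G_def mult.assoc)
  finally have "fps_nth ((1 + fps_const z * fps_X) * dilate q G) (Suc N)
    = fps_nth ((1 - fps_X) * G) (Suc N)"
    by simp
  then have "(1 - q ^ Suc N) * fps_nth G (Suc N) = (1 + z * q ^ N) * fps_nth G N"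
    by (simp add: distrib_right mult.assoc) (simp add: algebra_simps)
  also have "\<dots> = (1 - q ^ Suc N) * (qpoch (- z) q (Suc N) * inverse (qpoch q q (Suc N)))"
    using Suc inverse_qpoch_Suc[OF q, of N, symmetric]
    by (simp add: G_def qpoch_Suc[of "- z"] mult_ac)
  finally have "(1 - q ^ Suc N) * fps_nth G (Suc N)
    = (1 - q ^ Suc N) * (qpoch (- z) q (Suc N) * inverse (qpoch q q (Suc N)))" .
  moreover have "fps_nth (1 - q ^ Suc N) 0 \<noteq> 0"
    using q by simp
  then have "1 - q ^ Suc N \<noteq> 0"
    by (metis fps_zero_nth)
  ultimately show ?case
    unfolding G_def by (metis mult_left_cancel)
qed

section \<open>The even part of Euler's series\<close>

text \<open>The factors of \<open>(X; X)_N / (X; X)_k\<close> are \<open>1 - X^j\<close> with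
  \<open>j > k\<close>, so they leave coefficients up to \<open>k\<close> unchanged.\<close>

lemma qpoch_inverse_nth_stable:
  fixes F :: "'a::field fps"
  assumes "k \<le> N" "i \<le> k"
  shows "fps_nth (F * inverse (qpoch fps_X fps_X k) * qpoch fps_X fps_X N) i = fps_nth F i"
  using assms(1)
proof (induction N rule: dec_induct)
  case base
  have "inverse (qpoch fps_X fps_X k :: 'a fps) * qpoch fps_X fps_X k = 1"
    by (intro inverse_mult_eq_1) (simp add: qpoch_nth_0)
  then show ?case by (simp add: mult.assoc)
next
  case (step N)
  have "F * inverse (qpoch fps_X fps_X k) * qpoch fps_X fps_X (Suc N)
    = F * inverse (qpoch fps_X fps_X k) * qpoch fps_X fps_X N
      - F * inverse (qpoch fps_X fps_X k) * qpoch fps_X fps_X N * fps_X ^ Suc N"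
    by (simp add: qpoch_Suc algebra_simps)
  then show ?case
    using step assms(2) by (simp add: fps_X_power_mult_right_nth del: power_Suc)
qed

lemma sum_even_part:
  fixes f :: "nat \<Rightarrow> 'a::comm_ring_1"
  shows "(\<Sum>m<2 * N. (1 + (- 1) ^ m) * f m) = 2 * (\<Sum>n<N. f (2 * n))"
  by (induction N) (simp_all add: algebra_simps)

text \<open>Adding the finite q-binomial theorem at \<open>z = 1\<close> and \<open>z = -1\<close>
  keeps the even indices only. The bound on \<open>N\<close> ensures
  \<open>i \<le> Suc N - m\<close> for all \<open>m \<le> 2 * i\<close>.\<close>

lemma qpoch_nth_eq_even_sum:
  fixes i :: nat
  assumes N: "3 * i + 1 \<le> N"
  shows "fps_nth (qpoch (- fps_X) fps_X N :: 'a::field_char_0 fps) i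
    = (\<Sum>n\<le>i. fps_nth (fps_X ^ (n * (2 * n - 1)) * inverse (qpoch fps_X fps_X (2 * n))) i)"
proof -
  let ?v = "\<lambda>k. inverse (qpoch fps_X fps_X k) :: 'a fps"
  let ?T = "\<lambda>m. fps_X ^ (m choose 2) * ?v m"
  let ?P = "qpoch fps_X fps_X (Suc N) :: 'a fps"
  have P: "?v (Suc N) * ?P = 1"
    by (intro inverse_mult_eq_1) (simp add: qpoch_nth_0)
  have G: "(\<Sum>m\<le>Suc N. z ^ m * (?T m * ?v (Suc N - m) * ?P)) = qpoch (- z) fps_X (Suc N)" for z
  proof -
    have "qpoch (- z) fps_X (Suc N) = fps_nth (qExp fps_X z * qexp fps_X) (Suc N) * ?P"
      using P by (simp add: mult.commute[of "qExp fps_X z"] qexp_qExp_nth mult.assoc)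
    then show ?thesis
      by (simp only: fps_mult_nth qExp_def qexp_def atLeast0AtMost sum_distrib_right) (simp add: mult_ac)
  qed
  have "(\<Sum>m\<le>Suc N. (1 + (- 1) ^ m) * (?T m * ?v (Suc N - m) * ?P))
      = qpoch (- 1) fps_X (Suc N) + qpoch 1 fps_X (Suc N)"
    using G[of 1] G[of "- 1"] by (simp only: distrib_right sum.distrib) simp
  \<comment> \<open>The factor of index 0 is \<open>2\<close> in \<open>(-1; X)_(N+1)\<close> and
    \<open>0\<close> in \<open>(1; X)_(N+1)\<close>.\<close>
  also have "\<dots> = 2 * qpoch (- fps_X) fps_X N"
    by (simp add: qpoch_Suc_shift)
  finally have E: "(\<Sum>m\<le>Suc N. (1 + (- 1) ^ m) * (?T m * ?v (Suc N - m) * ?P))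
      = 2 * qpoch (- fps_X) fps_X N" .
  have two: "fps_nth (2 * F) i = 2 * fps_nth F i" for F :: "'a fps"
    by (simp only: mult_2 fps_add_nth)
  have "2 * fps_nth (qpoch (- fps_X) fps_X N :: 'a fps) i
      = fps_nth (\<Sum>m\<le>Suc N. (1 + (- 1) ^ m) * (?T m * ?v (Suc N - m) * ?P)) i"
    by (simp only: E two)
  also have "\<dots> = (\<Sum>m\<le>Suc N. (1 + (- 1) ^ m) * fps_nth (?T m * ?v (Suc N - m) * ?P) i)"
    unfolding fps_sum_nth by (intro sum.cong refl) (simp add: minus_one_power_iff two)
  \<comment> \<open>Terms with \<open>m \<ge> 2 * i + 2\<close> are divisible by
    \<open>X^(i+1)\<close>; the top remaining index \<open>2 * i + 1\<close> is odd, so its weight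
    vanishes.\<close>
  also have "\<dots> = (\<Sum>m<2 * Suc i. (1 + (- 1) ^ m) * fps_nth (?T m) i)"
  proof (rule sum.mono_neutral_cong_right)
    show "\<forall>m\<in>{..Suc N} - {..<2 * Suc i}. (1 + (- 1) ^ m) * fps_nth (?T m * ?v (Suc N - m) * ?P) i = 0"
    proof
      fix m assume "m \<in> {..Suc N} - {..<2 * Suc i}"
      then have "2 * Suc i \<le> m" by auto
      then obtain l where l: "m = Suc l" "i < l"
        by (cases m) auto
      then have "i < m choose 2"
        by (simp add: numeral_2_eq_2)
      then show "(1 + (- 1) ^ m) * fps_nth (?T m * ?v (Suc N - m) * ?P) i = 0"
        by (simp add: mult.assoc fps_X_power_mult_nth)
    qed
  next
    fix m assume "m \<in> {..<2 * Suc i}"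
    show "(1 + (- 1) ^ m) * fps_nth (?T m * ?v (Suc N - m) * ?P) i = (1 + (- 1) ^ m) * fps_nth (?T m) i"
    proof (cases "m \<le> 2 * i")
      case True
      then show ?thesis
        using N by (subst qpoch_inverse_nth_stable) auto
    next
      case False
      then have "m = 2 * i + 1" using \<open>m \<in> {..<2 * Suc i}\<close> by auto
      then show ?thesis by simp
    qed
  qed (use N in auto)
  also have "\<dots> = 2 * (\<Sum>n\<le>i. fps_nth (?T (2 * n)) i)"
    by (simp only: sum_even_part lessThan_Suc_atMost)
  finally have "fps_nth (qpoch (- fps_X) fps_X N :: 'a fps) i = (\<Sum>n\<le>i. fps_nth (?T (2 * n)) i)"
    by simp
  moreover have "2 * n choose 2 = n * (2 * n - 1)" for n :: nat
    by (simp add: choose_two)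
  ultimately show ?thesis by simp
qed

lemma qpoch_inf_nth_eq_even_sum:
  "fps_nth (qpoch_inf (- fps_X) fps_X :: 'a::field_char_0 fps) i
    = (\<Sum>n\<le>i. fps_nth (fps_X ^ (n * (2 * n - 1)) * inverse (qpoch fps_X fps_X (2 * n))) i)"
proof -
  define L :: "'a fps" where "L = Abs_fps (\<lambda>i.
    \<Sum>n\<le>i. fps_nth (fps_X ^ (n * (2 * n - 1)) * inverse (qpoch fps_X fps_X (2 * n))) i)"
  have "(\<lambda>N. qpoch (- fps_X) fps_X (Suc N)) \<longlonglongrightarrow> L"
    unfolding tendsto_fps_iff
  proof
    fix j
    show "\<forall>\<^sub>F N in sequentially. fps_nth (qpoch (- fps_X) fps_X (Suc N)) j = fps_nth L j"
      using eventually_ge_at_top[of "3 * j"]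
      by eventually_elim (simp add: qpoch_nth_eq_even_sum L_def)
  qed
  \<comment> \<open>An infinite product without zero factors must have a nonzero limit.\<close>
  moreover have "fps_nth L 0 = 1"
    by (simp add: L_def)
  then have "L \<noteq> 0"
    by auto
  ultimately have "(\<lambda>j. 1 - (- fps_X) * fps_X ^ j) has_prod L"
    by (simp add: has_prod_def raw_has_prod_def qpoch_def lessThan_Suc_atMost)
  then have "qpoch_inf (- fps_X) fps_X = L"
    unfolding qpoch_inf_def by (rule has_prod_unique[symmetric])
  then show ?thesis
    by (simp add: L_def)
qed

section \<open>The inner sum\<close>

lemma qint_mult: "(1 - q) * qint q m = 1 - q ^ m"
  by (simp add: qint_def one_diff_power_eq)

lemma qint_Suc_nth_0:
  assumes "fps_nth q 0 = 0"
  shows "fps_nth (qint q (Suc m)) 0 = 1"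
proof -
  have "fps_nth ((1 - q) * qint q (Suc m)) 0 = fps_nth (1 - q ^ Suc m) 0"
    by (simp only: qint_mult)
  then show ?thesis using assms by simp
qed

lemma qfact_mult: "(1 - q) ^ m * qfact q m = qpoch q q m"
proof (induction m)
  case (Suc m)
  have "(1 - q) ^ Suc m * qfact q (Suc m) = ((1 - q) ^ m * qfact q m) * ((1 - q) * qint q (Suc m))"
    by (simp add: qfact_def mult_ac)
  then show ?case by (simp add: Suc qint_mult qpoch_Suc)
qed (simp add: qfact_def)

lemma qfact_nth_0:
  assumes "fps_nth q 0 = 0"
  shows "fps_nth (qfact q m) 0 = 1"
  using assms by (induction m) (simp_all add: qfact_def qint_Suc_nth_0)

text \<open>The powers of \<open>1 - q\<close> that turn q-factorials into q-Pochhammer products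
  cancel because \<open>j + (m - j) = m\<close>.\<close>

lemma qbinom_eq:
  fixes q :: "'a::field fps"
  assumes q: "fps_nth q 0 = 0" and "j \<le> m"
  shows "qbinom q m j * inverse (qpoch q q m) = inverse (qpoch q q j) * inverse (qpoch q q (m - j))"
proof -
  have u: "fps_nth (qfact q j * qfact q (m - j)) 0 \<noteq> 0"
    using q by (simp add: qfact_nth_0)
  have i: "inverse (qpoch q q l) * qpoch q q l = 1" for l
    by (intro inverse_mult_eq_1) (simp add: qpoch_nth_0 q)
  have "qbinom q m j * (qfact q j * qfact q (m - j)) = qfact q m"
    unfolding qbinom_def using u by (simp add: fps_divide_unit inverse_mult_eq_1 mult.assoc)
  then have "(1 - q) ^ j * (1 - q) ^ (m - j) * (qbinom q m j * (qfact q j * qfact q (m - j)))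
      = (1 - q) ^ m * qfact q m"
    using \<open>j \<le> m\<close> by (simp flip: power_add)
  then have b: "qbinom q m j * (qpoch q q j * qpoch q q (m - j)) = qpoch q q m"
    by (simp flip: qfact_mult add: mult_ac)
  have "qbinom q m j * inverse (qpoch q q m)
      = qbinom q m j * inverse (qpoch q q m) * (inverse (qpoch q q j) * qpoch q q j)
        * (inverse (qpoch q q (m - j)) * qpoch q q (m - j))"
    by (simp add: i)
  also have "\<dots> = (qbinom q m j * (qpoch q q j * qpoch q q (m - j))) * inverse (qpoch q q m)
      * (inverse (qpoch q q j) * inverse (qpoch q q (m - j)))"
    by (simp only: mult_ac)
  also have "\<dots> = inverse (qpoch q q j) * inverse (qpoch q q (m - j))"
    using i[of m] by (simp only: b mult.commute[of "qpoch q q m"] mult_1)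
  finally show ?thesis .
qed

text \<open>Both sides are divided by \<open>(q; q)\<^sub>N\<close>; without this, the claim reads
  \<open>q\<^sup>k Y(N - k, k) = [N, k] - [N, k - 1]\<close>.\<close>

lemma qYamanouchi_eq:
  fixes q :: "'a::field fps"
  defines "v \<equiv> \<lambda>k. inverse (qpoch q q k)"
  assumes q: "fps_nth q 0 = 0" and k: "2 * k \<le> N"
  shows "q ^ k * qYamanouchi q (N - k) k * v N
    = v k * v (N - k) - (if k = 0 then 0 else v (k - 1) * v (N - (k - 1)))"
proof -
  define I where "I = inverse (qint q (Suc (N - k)))"
  have I: "I * qint q (Suc (N - k)) = 1"
    unfolding I_def by (intro inverse_mult_eq_1) (simp add: qint_Suc_nth_0 q)
  have rec: "(1 - q ^ Suc l) * v (Suc l) = v l" for l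
    unfolding v_def by (rule inverse_qpoch_Suc[OF q])
  have B: "qbinom q N (N - k) * v N = v (N - k) * v k"
    using qbinom_eq[OF q, of "N - k" N] k by (simp add: v_def)
  have "qYamanouchi q (N - k) k * v N = I * qint q (Suc (N - 2 * k)) * (qbinom q N (N - k) * v N)"
    using k by (simp add: qYamanouchi_def I_def fps_divide_unit qint_Suc_nth_0 q mult_ac flip: mult_2)
  \<comment> \<open>The recurrence supplies \<open>1 - q^(N-k+1)\<close>, which cancels the
    denominator \<open>[N-k+1]\<close> up to a factor \<open>1 - q\<close>.\<close>
  also have "\<dots> = I * qint q (Suc (N - 2 * k)) * (1 - q ^ Suc (N - k)) * v (Suc (N - k)) * v k"
    by (simp only: B mult.assoc rec)
  also have "\<dots> = (I * qint q (Suc (N - k))) * ((1 - q) * qint q (Suc (N - 2 * k))) * v (Suc (N - k)) * v k"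
    by (simp only: qint_mult[symmetric] mult_ac)
  also have "\<dots> = (1 - q ^ Suc (N - 2 * k)) * v (Suc (N - k)) * v k"
    by (simp only: I qint_mult mult_1)
  finally have "q ^ k * qYamanouchi q (N - k) k * v N
      = q ^ k * ((1 - q ^ Suc (N - 2 * k)) * v (Suc (N - k)) * v k)"
    by (simp only: mult.assoc)
  also have "\<dots> = (q ^ k - q ^ (k + Suc (N - 2 * k))) * v (Suc (N - k)) * v k"
    by (simp only: power_add right_diff_distrib mult_1_right flip: mult.assoc)
  also have "k + Suc (N - 2 * k) = Suc (N - k)"
    using k by simp
  \<comment> \<open>Written as \<open>(1 - q^(N-k+1)) - (1 - q^k)\<close>, each bracket lowers one
    index of \<open>v\<close>; for \<open>k = 0\<close> the second bracket vanishes, matching the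
    default \<open>0\<close>.\<close>
  also have "(q ^ k - q ^ Suc (N - k)) * v (Suc (N - k)) * v k
      = v k * ((1 - q ^ Suc (N - k)) * v (Suc (N - k))) - ((1 - q ^ k) * v k) * v (Suc (N - k))"
    by (simp add: algebra_simps)
  also have "\<dots> = v k * v (N - k) - (if k = 0 then 0 else v (k - 1) * v (N - (k - 1)))"
  proof (cases k)
    case (Suc l)
    then have "N - l = Suc (N - k)" using k by simp
    then show ?thesis using Suc rec by simp
  qed (simp only: rec, simp)
  finally show ?thesis .
qed

text \<open>The left side is the block \<open>q^j + ... + q^(2n-j)\<close>; removing both end terms
  leaves the block for \<open>j + 1\<close>.\<close>

lemma qint_shift_diff:
  assumes "j < n"
  shows "q ^ j * qint q (2 * (n - j) + 1)
    = q ^ j + q ^ (2 * n - j) + q ^ Suc j * qint q (2 * (n - Suc j) + 1)"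
proof -
  obtain l where l: "n = Suc (j + l)"
    using assms less_iff_Suc_add by auto
  have "qint q (2 * Suc l + 1) = qint q (Suc (2 * l + 1)) + q ^ (2 * Suc l)"
    by (simp add: qint_def)
  also have "qint q (Suc (2 * l + 1)) = 1 + q * qint q (2 * l + 1)"
    unfolding qint_def sum.lessThan_Suc_shift by (simp add: sum_distrib_left distrib_left)
  finally have "qint q (2 * Suc l + 1) = 1 + q * qint q (2 * l + 1) + q ^ (2 * Suc l)" .
  moreover have "2 * n - j = j + 2 * Suc l" using l by simp
  ultimately show ?thesis
    using l by (simp add: power_add algebra_simps)
qed

text \<open>Abel summation gives \<open>g k\<close> the weight \<open>q^k + q^(2n-k)\<close>; by
  symmetry the second power moves to index \<open>2n - k\<close> and fills the upper half of the
  range.\<close>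

lemma sum_by_parts_symmetric:
  fixes g :: "nat \<Rightarrow> 'a::field fps"
  assumes sym: "\<And>k. k \<le> 2 * n \<Longrightarrow> g (2 * n - k) = g k"
  shows "(\<Sum>k\<le>n. q ^ k * qint q (2 * (n - k) + 1) * (g k - (if k = 0 then 0 else g (k - 1))))
    = (\<Sum>k\<le>2 * n. q ^ k * g k)"
proof -
  \<comment> \<open>The boundary term is kept for the induction; at \<open>j = n\<close> its weight
    is just \<open>q^n\<close>.\<close>
  have "(\<Sum>k\<le>j. q ^ k * qint q (2 * (n - k) + 1) * (g k - (if k = 0 then 0 else g (k - 1))))
      = (\<Sum>k<j. (q ^ k + q ^ (2 * n - k)) * g k) + q ^ j * qint q (2 * (n - j) + 1) * g j"
    if "j \<le> n" for j
    using that
  proof (induction j)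
    case (Suc j)
    then show ?case
      using qint_shift_diff[of j n q] by (simp add: algebra_simps)
  qed simp
  from this[of n]
  have "(\<Sum>k\<le>n. q ^ k * qint q (2 * (n - k) + 1) * (g k - (if k = 0 then 0 else g (k - 1))))
      = (\<Sum>k<n. q ^ k * g k) + (\<Sum>k<n. q ^ (2 * n - k) * g k) + q ^ n * g n"
    by (simp add: qint_def distrib_right sum.distrib)
  also have "(\<Sum>k<n. q ^ (2 * n - k) * g k) = (\<Sum>k\<in>{n<..2 * n}. q ^ k * g k)"
    by (rule sum.reindex_bij_witness[of _ "\<lambda>k. 2 * n - k" "\<lambda>k. 2 * n - k"]) (auto simp: sym)
  also have "(\<Sum>k<n. q ^ k * g k) + (\<Sum>k\<in>{n<..2 * n}. q ^ k * g k) + q ^ n * g n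
      = (\<Sum>k\<in>{..n} \<union> {n<..2 * n}. q ^ k * g k)"
    by (subst sum.union_disjoint) (auto simp flip: lessThan_Suc_atMost)
  also have "{..n} \<union> {n<..2 * n} = {..2 * n}"
    by auto
  finally show ?thesis .
qed

text \<open>Of \<open>q^(3k)\<close>, the part \<open>q^(2k)\<close> makes the q-Yamanouchi number a
  difference in base \<open>q^2\<close>, and \<open>q^k\<close> remains as the weight for summation
  by parts.\<close>

lemma inner_sum:
  fixes q :: "'a::field fps"
  assumes q: "fps_nth q 0 = 0"
  shows "(\<Sum>k\<le>n. q ^ (e + 3 * k) * qYamanouchi (q ^ 2) (2 * n - k) k
      * inverse (qpoch (q ^ 2) (q ^ 2) (2 * n)) * qint q (2 * (n - k) + 1))
    = q ^ e * inverse (qpoch q q (2 * n))"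
proof -
  define v where "v k = inverse (qpoch (q ^ 2) (q ^ 2) k)" for k
  define g where "g k = v k * v (2 * n - k)" for k
  have "q ^ (e + 3 * k) * qYamanouchi (q ^ 2) (2 * n - k) k * v (2 * n) * qint q (2 * (n - k) + 1)
      = q ^ e * (q ^ k * qint q (2 * (n - k) + 1) * (g k - (if k = 0 then 0 else g (k - 1))))"
    if "k \<le> n" for k
  proof -
    have Y: "(q ^ 2) ^ k * qYamanouchi (q ^ 2) (2 * n - k) k * v (2 * n)
        = g k - (if k = 0 then 0 else g (k - 1))"
      using qYamanouchi_eq[of "q ^ 2" k "2 * n"] q that by (simp add: v_def g_def)
    have "e + 3 * k = e + k + 2 * k"
      by simp
    then have "q ^ (e + 3 * k) = q ^ e * q ^ k * (q ^ 2) ^ k"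
      by (simp only: power_add power_mult)
    then have "q ^ (e + 3 * k) * qYamanouchi (q ^ 2) (2 * n - k) k * v (2 * n) * qint q (2 * (n - k) + 1)
        = q ^ e * (q ^ k * qint q (2 * (n - k) + 1)
          * ((q ^ 2) ^ k * qYamanouchi (q ^ 2) (2 * n - k) k * v (2 * n)))"
      by (simp only: mult_ac)
    then show ?thesis
      by (simp only: Y)
  qed
  then have "(\<Sum>k\<le>n. q ^ (e + 3 * k) * qYamanouchi (q ^ 2) (2 * n - k) k
      * v (2 * n) * qint q (2 * (n - k) + 1))
    = q ^ e * (\<Sum>k\<le>n. q ^ k * qint q (2 * (n - k) + 1) * (g k - (if k = 0 then 0 else g (k - 1))))"
    unfolding sum_distrib_left by (intro sum.cong) auto
  also have "\<dots> = q ^ e * (\<Sum>k\<le>2 * n. q ^ k * g k)"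
    by (subst sum_by_parts_symmetric) (auto simp: g_def mult.commute)
  also have "\<dots> = q ^ e * inverse (qpoch q q (2 * n))"
    using sum_inverse_qpoch_square[OF q, of "2 * n"] by (simp add: g_def v_def)
  finally show ?thesis by (simp add: v_def)
qed

section \<open>Coefficientwise evaluation of the double sum\<close>

theorem theorem1p16:
  shows "((\<lambda>(n, k).
            fps_X ^ (n * (2 * n - 1) + 3 * k)
            * qYamanouchi (fps_X ^ 2) (2 * n - k) k
            * inverse (qpoch (fps_X ^ 2) (fps_X ^ 2) (2 * n))
            * qint fps_X (2 * (n - k) + 1))
          has_sum (qpoch_inf (- fps_X) fps_X :: 'a::field_char_0 fps))
         {(n, k). k \<le> n}"
  (is "(?f has_sum ?S) ?A")
  unfolding has_sum_def tendsto_fps_iff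
proof
  fix i :: nat
  \<comment> \<open>Pairs outside \<open>F0\<close> have exponent at least \<open>n > i\<close>, so
    coefficient \<open>i\<close> is the same for all finite partial sums containing
    \<open>F0\<close>.\<close>
  define F0 where "F0 = (SIGMA n:{..i}. {..n})"
  have zero: "fps_nth (?f p) i = 0" if p_in: "p \<in> ?A - F0" for p
  proof -
    obtain n k where p: "p = (n, k)" "i < n"
      using p_in by (cases p) (auto simp: F0_def)
    have "n * 1 \<le> n * (2 * n - 1)"
      using p by (intro mult_le_mono2) simp
    with p(2) have "i < n * (2 * n - 1) + 3 * k" by linarith
    then show ?thesis
      using p by (simp add: mult.assoc fps_X_power_mult_nth)
  qed
  have F0: "finite F0" "F0 \<subseteq> ?A"
    by (auto simp: F0_def)
  have "fps_nth (sum ?f F) i = fps_nth ?S i" if "finite F" "F0 \<subseteq> F" "F \<subseteq> ?A" for F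
  proof -
    have "fps_nth (sum ?f F) i = (\<Sum>p\<in>F0. fps_nth (?f p) i)"
      unfolding fps_sum_nth using that zero by (intro sum.mono_neutral_right) auto
    also have "\<dots> = fps_nth (\<Sum>p\<in>F0. ?f p) i"
      by (simp only: fps_sum_nth)
    also have "(\<Sum>p\<in>F0. ?f p)
        = (\<Sum>n\<le>i. fps_X ^ (n * (2 * n - 1)) * inverse (qpoch fps_X fps_X (2 * n)))"
      unfolding F0_def by (subst sum.Sigma[symmetric]) (simp_all add: inner_sum[simplified])
    finally show ?thesis
      by (simp add: fps_sum_nth qpoch_inf_nth_eq_even_sum)
  qed
  then show "\<forall>\<^sub>F F in finite_subsets_at_top ?A. fps_nth (sum ?f F) i = fps_nth ?S i"
    unfolding eventually_finite_subsets_at_top using F0 by blast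
qed

end
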